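(* As identities of formal power series in $q$ (equivalently, of holomorphic functions of $q$ with $|q|<1$), \[ (q;q)_\infty^{-2} \left(q^2;q^2\right)_\infty^{-2}\sum_{\substack{ n_1 \geq 0 \\ n_2 \in \mathbb{Z}}} {\rm sgn}^*(n_2)(-1)^{n_1} q^{\frac{n_1(n_1+1)}{2}+n_1n_2+2n_2^2+2n_2 } = \sum_{\substack{n_1,n_2,n_3\in \mathbb{N}_0\\ n_4\in\mathbb{Z}}} \frac{q^{2n_1+2n_2+2n_3+ 3 |n_4| }}{(q^2;q^2)_{n_1} (q^2;q^2)_{n_1+|n_4|}(q^2;q^2)_{n_2} (q^2;q^2)_{n_2+ |n_4|} (q^2;q^2)_{n_3} (q^2;q^2)_{n_3+ |n_4|}}. \]
   Context: For $n\in\mathbb{N}_0\cup\{\infty\}$, $(a;q)_n:=\prod_{j=0}^{n-1}(1-aq^j)$. ${\rm sgn}^*(n):=1$ if $n\ge 0$ and ${\rm sgn}^*(n):=-1$ if $n<0$. $\mathbb{N}_0=\{0,1,2,\dots\}$. *)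

theory Defs
  imports "HOL-Analysis.Analysis"
begin

definition qpoch :: "complex \<Rightarrow> complex \<Rightarrow> nat \<Rightarrow> complex" where
  "qpoch a q n = (\<Prod>j<n. 1 - a * q ^ j)"

definition qpoch_inf :: "complex \<Rightarrow> complex \<Rightarrow> complex" where
  "qpoch_inf a q = (\<Prod>j. 1 - a * q ^ j)"

definition sgn_star :: "int \<Rightarrow> int" where
  "sgn_star n = (if n \<ge> 0 then 1 else -1)"

end

theory Submission
  imports Defs
begin

text \<open>
  Let \<open>G\<^sub>k\<close> be the Laurent coefficients of \<open>1 / ((qw;q\<^sup>2)\<^sub>\<infinity> (q/w;q\<^sup>2)\<^sub>\<infinity>)\<close>. Summing over \<open>n\<^sub>1, n\<^sub>2, n\<^sub>3\<close>
  for fixed \<open>n\<^sub>4 = k\<close> turns the right-hand side into \<open>\<Sum>\<^sub>k G\<^sub>k\<^sup>3\<close>. By Euler's two identities \<open>G\<^sub>k\<close> is, up to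
  \<open>q\<^sup>k\<close> and \<open>(q\<^sup>2;q\<^sup>2)\<^sub>\<infinity>\<^sup>2\<close>, a partial theta function, and regrouping the product of two partial theta
  functions along the diagonal gives
  \<open>(q\<^sup>2;q\<^sup>2)\<^sub>\<infinity>\<^sup>2 G\<^sub>k\<^sup>2 = \<Sum>\<^sub>n sgn\<^sup>*(n) q\<^bsup>2n(n+1)\<^esup> H\<^bsub>-n-k\<^esub>\<close>, where \<open>H\<^sub>k\<close> are the Laurent coefficients of
  \<open>1 / ((q\<^sup>2w;q\<^sup>2)\<^sub>\<infinity> (1/w;q\<^sup>2)\<^sub>\<infinity>)\<close>. The product of the two generating functions is
  \<open>1 / ((qw;q)\<^sub>\<infinity> (1/w;q)\<^sub>\<infinity>)\<close>, so \<open>\<Sum>\<^sub>k G\<^sub>k H\<^bsub>-n-k\<^esub>\<close> is one of its coefficients, and these are again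
  partial theta functions, now in base \<open>q\<close>.
\<close>

section \<open>Summability\<close>

lemma summable_on_times_nonneg:
  fixes f :: "'a \<Rightarrow> real" and g :: "'b \<Rightarrow> real"
  assumes "f summable_on A" "g summable_on B" "\<And>x. f x \<ge> 0" "\<And>y. g y \<ge> 0"
  shows "(\<lambda>(x, y). f x * g y) summable_on A \<times> B"
proof (rule summable_on_SigmaI)
  show "((\<lambda>y. case (x, y) of (x, y) \<Rightarrow> f x * g y) has_sum f x * infsum g B) B" for x
    using has_sum_cmult_right[OF has_sum_infsum[OF assms(2)], of "f x"] by simp
  show "(\<lambda>x. f x * infsum g B) summable_on A"
    by (rule summable_on_cmult_left[OF assms(1)])
qed (use assms in auto)

text \<open>Summability of a complex family is absolute summability, so the question reduces to the
  products of norms, a nonnegative real family.\<close>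

lemma summable_on_times_complex:
  fixes f :: "'a \<Rightarrow> complex" and g :: "'b \<Rightarrow> complex"
  assumes "f summable_on A" "g summable_on B"
  shows "(\<lambda>(x, y). f x * g y) summable_on A \<times> B"
proof -
  have "(\<lambda>(x, y). norm (f x) * norm (g y)) summable_on A \<times> B"
    using assms by (intro summable_on_times_nonneg) (auto simp flip: summable_on_iff_abs_summable_on_complex)
  then show ?thesis
    by (simp add: summable_on_iff_abs_summable_on_complex case_prod_unfold norm_mult)
qed

lemma infsum_times_complex:
  fixes f :: "'a \<Rightarrow> complex" and g :: "'b \<Rightarrow> complex"
  assumes "f summable_on A" "g summable_on B"
  shows "infsum f A * infsum g B = (\<Sum>\<^sub>\<infinity>(x, y)\<in>A \<times> B. f x * g y)"
proof -
  have "(\<Sum>\<^sub>\<infinity>(x, y)\<in>A \<times> B. f x * g y) = (\<Sum>\<^sub>\<infinity>x\<in>A. \<Sum>\<^sub>\<infinity>y\<in>B. f x * g y)"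
    using summable_on_times_complex[OF assms] by (simp add: infsum_Sigma'_banach)
  also have "\<dots> = infsum f A * infsum g B"
    by (simp add: infsum_cmult_right' infsum_cmult_left')
  finally show ?thesis by simp
qed

lemma summable_on_complex_comparison:
  fixes f :: "'a \<Rightarrow> complex"
  assumes "g summable_on A" "\<And>x. x \<in> A \<Longrightarrow> norm (f x) \<le> g x"
  shows "f summable_on A"
  using summable_on_comparison_test[OF assms] by (auto intro: abs_summable_summable)

lemma summable_on_geometric:
  fixes t :: real
  assumes "0 \<le> t" "t < 1"
  shows "(\<lambda>n::nat. t ^ n) summable_on UNIV"
  using assms by (subst summable_on_UNIV_nonneg_real_iff) (auto intro: summable_geometric)

lemma summable_on_geometric_int:
  fixes t :: real
  assumes "0 \<le> t" "t < 1"
  shows "(\<lambda>n::int. t ^ nat \<bar>n\<bar>) summable_on UNIV"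
proof -
  have 1: "(\<lambda>n::int. t ^ nat \<bar>n\<bar>) summable_on {0..}"
    using summable_on_geometric[OF assms]
    by (subst summable_on_reindex_bij_witness[where i = int and j = nat and T = UNIV and h = "\<lambda>n. t ^ n"]) auto
  have "(\<lambda>n::int. t ^ nat \<bar>n\<bar>) summable_on {..0}"
    using summable_on_geometric[OF assms]
    by (subst summable_on_reindex_bij_witness[where i = "\<lambda>n. - int n" and j = "\<lambda>n. nat (- n)" and T = UNIV and h = "\<lambda>n. t ^ n"]) auto
  then have "(\<lambda>n::int. t ^ nat \<bar>n\<bar>) summable_on {..<0}"
    by (rule summable_on_subset_banach) auto
  then have "(\<lambda>n::int. t ^ nat \<bar>n\<bar>) summable_on {..<0} \<union> {0..}"
    using 1 by (intro summable_on_Un_disjoint) auto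
  moreover have "{..<0} \<union> {0..} = (UNIV :: int set)" by auto
  ultimately show ?thesis by simp
qed

section \<open>Series with a quadratic exponent\<close>

lemma choose_two_Suc: "Suc r choose 2 = (r choose 2) + r"
  by (simp add: numeral_2_eq_2)

text \<open>The ratio of consecutive terms is \<open>t ^ r * y\<close>, which tends to 0 however
  large \<open>y\<close> is. Large \<open>y\<close> does occur: partial theta series lead to
  \<open>y = t powi (j + 1)\<close> with negative exponents.\<close>

lemma summable_quadratic_exponent:
  fixes t y :: real
  assumes "0 \<le> t" "t < 1" "0 \<le> y"
  shows "summable (\<lambda>r. t ^ (r choose 2) * y ^ r)"
proof -
  have "(\<lambda>r. t ^ r * y) \<longlonglongrightarrow> 0 * y"
    using assms by (intro tendsto_mult LIMSEQ_power_zero) auto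
  then have "eventually (\<lambda>r. t ^ r * y < 1/2) sequentially"
    by (rule order_tendstoD) auto
  then obtain N where N: "\<And>r. r \<ge> N \<Longrightarrow> t ^ r * y < 1/2"
    by (auto simp: eventually_sequentially)
  show ?thesis
  proof (rule summable_ratio_test[of "1/2" N])
    fix r assume "N \<le> r"
    then have "(t ^ (r choose 2) * y ^ r) * (t ^ r * y) \<le> (t ^ (r choose 2) * y ^ r) * (1/2)"
      using N[of r] assms by (intro mult_left_mono) auto
    then show "norm (t ^ (Suc r choose 2) * y ^ Suc r) \<le> 1/2 * norm (t ^ (r choose 2) * y ^ r)"
      using assms by (simp add: choose_two_Suc power_add mult_ac)
  qed simp
qed

section \<open>Euler's identities\<close>

lemma one_minus_power_nonzero:
  fixes x :: complex
  assumes "norm x < 1" 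
  shows "1 - x * x ^ n \<noteq> 0"
proof
  assume "1 - x * x ^ n = 0"
  then have "norm (x ^ Suc n) = 1" by (metis eq_iff_diff_eq_0 norm_one power_Suc)
  moreover have "norm (x ^ Suc n) < 1"
    unfolding norm_power using assms by (simp add: power_less_one_iff del: power_Suc)
  ultimately show False by simp
qed

lemma qpoch_Suc: "qpoch a x (Suc n) = qpoch a x n * (1 - a * x ^ n)"
  by (simp add: qpoch_def)

lemma qpoch_0 [simp]: "qpoch a x 0 = 1"
  by (simp add: qpoch_def)

lemma qpoch_nonzero:
  assumes "norm x < 1"
  shows "qpoch x x n \<noteq> 0"
  using one_minus_power_nonzero[OF assms] by (auto simp: qpoch_def)

lemma inverse_qpoch_Suc:
  assumes "norm x < 1"
  shows "1 / qpoch x x (Suc n) * (1 - x * x ^ n) = 1 / qpoch x x n"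
  using one_minus_power_nonzero[OF assms, of n] by (simp add: qpoch_Suc)

lemma convergent_prod_qpoch:
  fixes a x :: complex
  assumes "norm x < 1"
  shows "convergent_prod (\<lambda>j. 1 - a * x ^ j)"
  using assms
  by (intro abs_convergent_prod_imp_convergent_prod summable_imp_abs_convergent_prod)
     (auto simp: norm_mult norm_power intro!: summable_mult summable_geometric)

lemma qpoch_tendsto:
  assumes "norm x < 1"
  shows "(\<lambda>n. qpoch a x n) \<longlonglongrightarrow> qpoch_inf a x"
proof -
  have "(\<lambda>n. \<Prod>i\<le>n. 1 - a * x ^ i) \<longlonglongrightarrow> qpoch_inf a x"
    unfolding qpoch_inf_def by (rule convergent_prod_LIMSEQ[OF convergent_prod_qpoch[OF assms]])
  then have "(\<lambda>n. qpoch a x (Suc n)) \<longlonglongrightarrow> qpoch_inf a x"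
    by (simp add: qpoch_def lessThan_Suc_atMost)
  then show ?thesis by (rule LIMSEQ_imp_Suc)
qed

lemma qpoch_inf_nonzero:
  assumes "norm x < 1"
  shows "qpoch_inf x x \<noteq> 0"
  unfolding qpoch_inf_def
  using one_minus_power_nonzero[OF assms]
  by (intro prodinf_nonzero convergent_prod_qpoch assms) auto

lemma qpoch_shift: "qpoch a x (n + m) = qpoch a x n * qpoch (a * x ^ n) x m"
  by (induction m) (simp_all add: qpoch_Suc power_add mult_ac)

lemma qpoch_inf_shift:
  assumes "norm x < 1"
  shows "qpoch_inf a x = qpoch a x n * qpoch_inf (a * x ^ n) x"
proof -
  have "(\<lambda>m. qpoch a x (m + n)) \<longlonglongrightarrow> qpoch_inf a x"
    by (rule LIMSEQ_ignore_initial_segment[OF qpoch_tendsto[OF assms]])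
  moreover have "(\<lambda>m. qpoch a x (m + n)) \<longlonglongrightarrow> qpoch a x n * qpoch_inf (a * x ^ n) x"
    unfolding add.commute[of _ n] qpoch_shift by (intro tendsto_mult qpoch_tendsto assms tendsto_const)
  ultimately show ?thesis by (rule LIMSEQ_unique)
qed

text \<open>The reciprocals converge because the limit \<open>qpoch_inf x x\<close> is nonzero. The
  constant \<open>M\<close> enters most of the majorants below.\<close>

lemma inverse_qpoch_bounded:
  assumes "norm x < 1"
  obtains M where "M > 0" "\<And>n. norm (1 / qpoch x x n) \<le> M"
proof -
  have "(\<lambda>n. 1 / qpoch x x n) \<longlonglongrightarrow> 1 / qpoch_inf x x"
    by (intro tendsto_divide qpoch_tendsto assms qpoch_inf_nonzero tendsto_const)
  then have "Bseq (\<lambda>n. 1 / qpoch x x n)"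
    using Bseq_eq_bounded convergent_imp_Bseq convergentI by blast
  then show ?thesis using that unfolding Bseq_def by blast
qed

section \<open>Euler's sums from their functional equations\<close>

lemma has_sum_powser_nat:
  fixes c :: "nat \<Rightarrow> complex"
  assumes "summable (\<lambda>n. norm (c n * z ^ n))"
  shows "((\<lambda>n. c n * z ^ n) has_sum (\<Sum>n. c n * z ^ n)) UNIV"
  by (rule norm_summable_imp_has_sum[OF assms summable_sums[OF summable_norm_cancel[OF assms]]])

text \<open>A power series converging at some nonzero \<open>K\<close> is continuous at 0. This
  gives the limit of a functional equation iterated along \<open>z\<close>, \<open>z * x\<close>,
  \<open>z * x ^ 2\<close> and so on.\<close>

lemma powser_tendsto_at_power:
  fixes c :: "nat \<Rightarrow> complex"
  assumes "summable (\<lambda>n. norm (c n * K ^ n))" "K \<noteq> 0" "norm x < 1"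
  shows "(\<lambda>N. \<Sum>n. c n * (z * x ^ N) ^ n) \<longlonglongrightarrow> c 0"
proof -
  have "isCont (\<lambda>z. \<Sum>n. c n * z ^ n) 0"
    using isCont_powser[OF summable_norm_cancel[OF assms(1)], of 0] assms(2) by simp
  moreover have "(\<lambda>N. z * x ^ N) \<longlonglongrightarrow> z * 0"
    using assms by (intro tendsto_mult LIMSEQ_power_zero) auto
  ultimately have "(\<lambda>N. (\<Sum>n. c n * (z * x ^ N) ^ n)) \<longlonglongrightarrow> (\<Sum>n. c n * 0 ^ n)"
    using isCont_tendsto_compose[of 0 "\<lambda>z. \<Sum>n. c n * z ^ n"] by simp
  then show ?thesis by (simp only: powser_zero)
qed

lemma summable_euler_inverse:
  assumes "norm x < 1" "norm z < 1"
  shows "summable (\<lambda>n. norm (1 / qpoch x x n * z ^ n))"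
proof -
  obtain M where M: "M > 0" "\<And>n. norm (1 / qpoch x x n) \<le> M"
    by (rule inverse_qpoch_bounded[OF assms(1)]) blast
  show ?thesis
  proof (rule summable_comparison_test_ev)
    show "summable (\<lambda>n. M * norm z ^ n)"
      using assms by (intro summable_mult summable_geometric) auto
    have "norm (1 / qpoch x x n * z ^ n) \<le> M * norm z ^ n" for n
      unfolding norm_mult norm_power by (intro mult_right_mono M) simp
    then show "eventually (\<lambda>n. norm (norm (1 / qpoch x x n * z ^ n)) \<le> M * norm z ^ n) sequentially"
      by simp
  qed
qed

text \<open>The recurrence of the coefficients gives \<open>(1 - z) * g z = g (z * x)\<close>.
  Iterating it produces \<open>qpoch z x N\<close> and drives the argument of \<open>g\<close> to 0,
  where \<open>g\<close> takes the value 1.\<close>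

lemma euler_inverse_sum:
  assumes "norm x < 1" "norm z < 1"
  shows "((\<lambda>n. 1 / qpoch x x n * z ^ n) has_sum 1 / qpoch_inf z x) UNIV"
proof -
  define g where "g = (\<lambda>z. \<Sum>n. 1 / qpoch x x n * z ^ n)"
  have sums: "(\<lambda>n. 1 / qpoch x x n * z ^ n) sums g z" if "norm z < 1" for z
    unfolding g_def
    by (rule summable_sums[OF summable_norm_cancel[OF summable_euler_inverse[OF assms(1) that]]])
  have step: "(1 - z) * g z = g (z * x)" if z: "norm z < 1" for z
  proof -
    have zx: "norm (z * x) < 1"
      using mult_left_mono[of "norm x" 1 "norm z"] z assms(1) by (simp add: norm_mult)
    have "(\<lambda>n. 1 / qpoch x x n * z ^ n - 1 / qpoch x x n * (z * x) ^ n) sums (g z - g (z * x))"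
      by (intro sums_diff sums z zx)
    \<comment> \<open>The term of index 0 is \<open>1 - 1 = 0\<close>, so the series may start at
      index 1.\<close>
    then have "(\<lambda>n. 1 / qpoch x x (Suc n) * z ^ Suc n - 1 / qpoch x x (Suc n) * (z * x) ^ Suc n)
                 sums (g z - g (z * x))"
      by (subst sums_Suc_iff) simp
    moreover have "1 / qpoch x x (Suc n) * z ^ Suc n - 1 / qpoch x x (Suc n) * (z * x) ^ Suc n
        = z * (1 / qpoch x x n * z ^ n)" for n
    proof -
      have "c * z ^ Suc n - c * (z * x) ^ Suc n = z * (c * (1 - x * x ^ n) * z ^ n)" for c
        by (simp add: algebra_simps)
      then show ?thesis by (simp only: inverse_qpoch_Suc[OF assms(1)])
    qed
    ultimately have "(\<lambda>n. z * (1 / qpoch x x n * z ^ n)) sums (g z - g (z * x))"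
      by simp
    moreover have "(\<lambda>n. z * (1 / qpoch x x n * z ^ n)) sums (z * g z)"
      by (intro sums_mult sums z)
    ultimately have "g z - g (z * x) = z * g z" by (rule sums_unique2)
    then show ?thesis by (simp add: algebra_simps)
  qed
  have iter: "qpoch z x N * g z = g (z * x ^ N)" for N
  proof (induction N)
    case (Suc N)
    have "norm (z * x ^ N) < 1"
      using mult_left_mono[OF power_le_one[of "norm x" N], of "norm z"] assms
      by (simp add: norm_mult norm_power)
    then have "(1 - z * x ^ N) * g (z * x ^ N) = g (z * x ^ Suc N)"
      by (subst step) (simp_all add: mult_ac)
    moreover have "qpoch z x (Suc N) * g z = (1 - z * x ^ N) * (qpoch z x N * g z)"
      by (simp add: qpoch_Suc)
    ultimately show ?case by (simp only: Suc)
  qed simp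
  \<comment> \<open>The point \<open>1/2\<close> serves as an arbitrary nonzero point of the unit
    disc.\<close>
  have "(\<lambda>N. g (z * x ^ N)) \<longlonglongrightarrow> 1"
    using powser_tendsto_at_power[of "\<lambda>n. 1 / qpoch x x n" "1/2" x z] assms
      summable_euler_inverse[OF assms(1), of "1/2"] unfolding g_def by simp
  moreover have "(\<lambda>N. g (z * x ^ N)) \<longlonglongrightarrow> qpoch_inf z x * g z"
    unfolding iter[symmetric] by (intro tendsto_mult qpoch_tendsto assms tendsto_const)
  ultimately have "qpoch_inf z x * g z = 1" by (metis LIMSEQ_unique)
  then have "g z = 1 / qpoch_inf z x"
    by (metis inverse_eq_divide inverse_unique)
  then show ?thesis
    using has_sum_powser_nat[OF summable_euler_inverse[OF assms]] by (simp add: g_def)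
qed

lemma summable_euler:
  assumes "norm x < 1"
  shows "summable (\<lambda>r. norm ((-1) ^ r * x ^ (r choose 2) / qpoch x x r * z ^ r))"
proof -
  obtain M where M: "M > 0" "\<And>n. norm (1 / qpoch x x n) \<le> M"
    by (rule inverse_qpoch_bounded[OF assms(1)]) blast
  show ?thesis
  proof (rule summable_comparison_test_ev)
    show "summable (\<lambda>r. M * (norm x ^ (r choose 2) * norm z ^ r))"
      using assms by (intro summable_mult summable_quadratic_exponent) auto
    have "norm ((-1) ^ r * x ^ (r choose 2) / qpoch x x r * z ^ r)
       \<le> M * (norm x ^ (r choose 2) * norm z ^ r)" for r
      using mult_right_mono[OF M(2)[of r], of "norm x ^ (r choose 2) * norm z ^ r"]
      by (simp add: norm_mult norm_divide norm_power)
    then show "eventually (\<lambda>r. norm (norm ((-1) ^ r * x ^ (r choose 2) / qpoch x x r * z ^ r))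
        \<le> M * (norm x ^ (r choose 2) * norm z ^ r)) sequentially"
      by simp
  qed
qed

text \<open>The same method with the functional equation \<open>g z = (1 - z) * g (z * x)\<close>.
  The quadratic exponent makes the series converge for every \<open>z\<close>.\<close>

lemma euler_sum:
  assumes "norm x < 1"
  shows "((\<lambda>r. (-1) ^ r * x ^ (r choose 2) / qpoch x x r * z ^ r) has_sum qpoch_inf z x) UNIV"
proof -
  define c where "c = (\<lambda>r. (-1) ^ r * x ^ (r choose 2) / qpoch x x r)"
  define g where "g = (\<lambda>z. \<Sum>n. c n * z ^ n)"
  have sums: "(\<lambda>n. c n * z ^ n) sums g z" for z
    unfolding g_def c_def
    by (rule summable_sums[OF summable_norm_cancel[OF summable_euler[OF assms]]])
  have step: "g z = (1 - z) * g (z * x)" for z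
  proof -
    have "(\<lambda>n. c n * z ^ n - c n * (z * x) ^ n) sums (g z - g (z * x))"
      by (intro sums_diff sums)
    then have "(\<lambda>n. c (Suc n) * z ^ Suc n - c (Suc n) * (z * x) ^ Suc n)
                 sums (g z - g (z * x))"
      by (subst sums_Suc_iff) simp
    moreover have "c (Suc n) * z ^ Suc n - c (Suc n) * (z * x) ^ Suc n
        = (- z) * (c n * (z * x) ^ n)" for n
    proof -
      have "c (Suc n) * z ^ Suc n - c (Suc n) * (z * x) ^ Suc n
         = c (Suc n) * (1 - x * x ^ n) * z ^ Suc n" by (simp add: algebra_simps)
      \<comment> \<open>Passing from \<open>n\<close> to \<open>Suc n\<close> flips the sign, adds
        \<open>n\<close> to the exponent \<open>n choose 2\<close> and puts the factor
        \<open>1 - x * x ^ n\<close> into the denominator.\<close>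
      also have "c (Suc n) * (1 - x * x ^ n) = - (c n * x ^ n)"
        using one_minus_power_nonzero[OF assms(1), of n] qpoch_nonzero[OF assms(1), of n]
        by (simp add: c_def qpoch_Suc choose_two_Suc power_add)
      finally show ?thesis by (simp add: power_mult_distrib)
    qed
    ultimately have "(\<lambda>n. (- z) * (c n * (z * x) ^ n)) sums (g z - g (z * x))"
      by simp
    moreover have "(\<lambda>n. (- z) * (c n * (z * x) ^ n)) sums ((- z) * g (z * x))"
      by (intro sums_mult sums)
    ultimately have "g z - g (z * x) = (- z) * g (z * x)" by (rule sums_unique2)
    then show ?thesis by (simp add: algebra_simps)
  qed
  have iter: "g z = qpoch z x N * g (z * x ^ N)" for N
  proof (induction N)
    case (Suc N)
    then show ?case using step[of "z * x ^ N"] by (simp add: qpoch_Suc mult_ac)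
  qed simp
  have "(\<lambda>N. g (z * x ^ N)) \<longlonglongrightarrow> 1"
    using powser_tendsto_at_power[of c 1 x z] assms
      summable_euler[OF assms(1), of 1] unfolding g_def c_def by (simp add: binomial_eq_0)
  then have "(\<lambda>N. qpoch z x N * g (z * x ^ N)) \<longlonglongrightarrow> qpoch_inf z x * 1"
    by (intro tendsto_mult qpoch_tendsto assms)
  then have "g z = qpoch_inf z x" unfolding iter[symmetric] by (simp add: LIMSEQ_const_iff)
  then show ?thesis
    using has_sum_powser_nat[of c z] summable_euler[OF assms, of z] by (simp add: g_def c_def)
qed

section \<open>Partial theta functions as Laurent coefficients\<close>

definition tri :: "int \<Rightarrow> int" where
  "tri t = t * (t + 1) div 2"

lemma two_tri: "2 * tri t = t * (t + 1)"
  unfolding tri_def by simp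

text \<open>The cross term of a quadratic function is bilinear. Regroupings of exponents under a
  shift of a summation index rest on this.\<close>

lemma tri_add: "tri (s + t) = tri s + tri t + s * t"
  using two_tri[of s] two_tri[of t] two_tri[of "s + t"] by (simp add: algebra_simps)

lemma tri_reflect: "tri (- 1 - t) = tri t"
  using two_tri[of t] two_tri[of "- 1 - t"] by (simp add: algebra_simps)

lemma tri_nonneg: "tri t \<ge> 0"
proof -
  have "t * (t + 1) \<ge> 0"
    by (cases "t \<ge> 0") (auto intro: mult_nonpos_nonpos)
  then show ?thesis unfolding tri_def by simp
qed

text \<open>The offset -1 accounts for \<open>tri (- 1) = 0\<close>. Negative arguments reduce to
  nonnegative ones by \<open>tri_reflect\<close>.\<close>

lemma tri_ge_abs: "\<bar>t\<bar> - 1 \<le> tri t"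
proof -
  have *: "s \<le> tri s" if "s \<ge> 0" for s
  proof -
    have "0 \<le> s * (s - 1)" using that by (cases "s = 0") auto
    then show ?thesis using two_tri[of s] by (simp add: algebra_simps)
  qed
  show ?thesis
    using *[of t] *[of "- 1 - t"] by (cases "t \<ge> 0") (auto simp: tri_reflect)
qed

lemma tri_of_nat: "tri (int r) = int (r choose 2) + int r"
proof (induction r)
  case (Suc r)
  have "tri (int r + 1) = tri (int r) + 1 + int r"
    by (subst tri_add) (simp add: tri_def)
  with Suc show ?case by (simp add: choose_two_Suc add.commute)
qed (simp add: tri_def binomial_eq_0)

lemma summable_on_tri:
  fixes t :: real
  assumes "0 < t" "t < 1"
  shows "(\<lambda>n. t powi tri n) summable_on UNIV"
proof (rule summable_on_comparison_test)
  \<comment> \<open>The factor \<open>1 / t\<close> absorbs the offset -1 of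
    \<open>tri_ge_abs\<close>.\<close>
  show "(\<lambda>n. (1 / t) * t ^ nat \<bar>n\<bar>) summable_on UNIV"
    using assms by (intro summable_on_cmult_right summable_on_geometric_int) auto
  show "t powi tri n \<le> (1 / t) * t ^ nat \<bar>n\<bar>" for n
  proof -
    have "t powi tri n \<le> t powi (\<bar>n\<bar> - 1)"
      using assms tri_ge_abs[of n] by (intro power_int_decreasing) auto
    also have "\<dots> = (1 / t) * t powi int (nat \<bar>n\<bar>)"
      using assms by (simp add: power_int_diff)
    also have "\<dots> = (1 / t) * t ^ nat \<bar>n\<bar>"
      unfolding power_int_of_nat ..
    finally show ?thesis .
  qed
qed (use assms in auto)

text \<open>For negative \<open>j\<close> some exponents are negative, so the value is meaningful only for \<open>x \<noteq> 0\<close>.\<close>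

definition partial_theta :: "complex \<Rightarrow> int \<Rightarrow> complex" where
  "partial_theta x j = (\<Sum>\<^sub>\<infinity>r. (-1) ^ r * x powi (tri (int r) + int r * j))"

text \<open>Brings the exponent to the shape of Euler's second sum, evaluated at
  \<open>z = x powi (j + 1)\<close>.\<close>

lemma power_int_tri:
  fixes x :: "'a :: field"
  assumes "x \<noteq> 0"
  shows "x powi (tri (int r) + int r * j) = x ^ (r choose 2) * (x powi (j + 1)) ^ r"
proof -
  have "x powi (tri (int r) + int r * j) = x powi (int (r choose 2) + (j + 1) * int r)"
    by (simp add: tri_of_nat algebra_simps)
  also have "\<dots> = x ^ (r choose 2) * (x powi (j + 1)) ^ r"
    using assms by (simp add: power_int_add power_int_mult)
  finally show ?thesis .
qed

lemma summable_on_partial_theta_real: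
  fixes t :: real
  assumes "0 < t" "t < 1"
  shows "(\<lambda>r. t powi (tri (int r) + int r * j)) summable_on UNIV"
proof -
  have "(\<lambda>r. t ^ (r choose 2) * (t powi (j + 1)) ^ r) summable_on UNIV"
    using assms by (subst summable_on_UNIV_nonneg_real_iff) (auto intro!: summable_quadratic_exponent)
  then show ?thesis using assms by (subst power_int_tri) auto
qed

lemma summable_on_partial_theta:
  fixes x :: complex
  assumes "x \<noteq> 0" "norm x < 1"
  shows "(\<lambda>r. (-1) ^ r * x powi (tri (int r) + int r * j)) summable_on UNIV"
  using summable_on_partial_theta_real[of "norm x" j] assms
  by (intro summable_on_complex_comparison[of "\<lambda>r. norm x powi (tri (int r) + int r * j)"])
     (auto simp: norm_mult norm_power norm_power_int)

text \<open>The Laurent coefficient of \<open>w\<^sup>j\<close> in \<open>1 / ((aw;x)\<^sub>\<infinity> (b/w;x)\<^sub>\<infinity>)\<close>.\<close>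

definition laurent_coeff :: "complex \<Rightarrow> complex \<Rightarrow> complex \<Rightarrow> int \<Rightarrow> complex" where
  "laurent_coeff a b x j =
     (\<Sum>\<^sub>\<infinity>(m, n)\<in>{(m, n). int m - int n = j}. a ^ m * b ^ n / (qpoch x x m * qpoch x x n))"

text \<open>For \<open>b < 0\<close> both sides vanish because \<open>(x\<^bsup>b+1\<^esup>;x)\<^sub>\<infinity>\<close> contains the factor \<open>1 - x\<^sup>0\<close>.\<close>

lemma euler_sum_int:
  assumes "x \<noteq> 0" "norm x < 1"
  shows "((\<lambda>r. (-1) ^ r * x powi (tri (int r) + int r * b) / qpoch x x r) has_sum
           qpoch_inf x x * (if b \<ge> 0 then 1 / qpoch x x (nat b) else 0)) UNIV"
proof -
  have "qpoch_inf (x powi (b + 1)) x = qpoch_inf x x * (if b \<ge> 0 then 1 / qpoch x x (nat b) else 0)"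
  proof (cases "b \<ge> 0")
    case True
    have "x powi (b + 1) = x * x powi (int (nat b))"
      using True assms by (simp add: power_int_add)
    also have "\<dots> = x * x ^ nat b"
      unfolding power_int_of_nat ..
    finally show ?thesis
      using True qpoch_inf_shift[OF assms(2), of x "nat b"] qpoch_nonzero[OF assms(2), of "nat b"]
      by simp
  next
    case False
    have "x powi (b + 1) * x ^ nat (- 1 - b) = x powi (b + 1) * x powi int (nat (- 1 - b))"
      unfolding power_int_of_nat ..
    also have "\<dots> = x powi (b + 1 + int (nat (- 1 - b)))"
      using assms by (subst power_int_add) auto
    also have "\<dots> = 1" using False by simp
    finally show ?thesis
      using False qpoch_inf_shift[OF assms(2), of "x powi (b + 1)" "Suc (nat (- 1 - b))"]
      by (simp add: qpoch_Suc)
  qed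
  moreover have "(-1) ^ r * x powi (tri (int r) + int r * b) / qpoch x x r =
                 (-1) ^ r * x ^ (r choose 2) / qpoch x x r * (x powi (b + 1)) ^ r" for r
    by (simp add: power_int_tri[OF assms(1)])
  ultimately show ?thesis
    using euler_sum[OF assms(2), of "x powi (b + 1)"] by (simp only:)
qed

text \<open>The coefficient is a single sum over \<open>a\<close> of
  \<open>x ^ a / (qpoch x x a * qpoch x x (a + j))\<close>. Expanding the second reciprocal by
  \<open>euler_sum_int\<close> gives a double sum \<open>t a r\<close>; after exchanging the order,
  \<open>euler_inverse_sum\<close> evaluates the sum over \<open>a\<close> and leaves the partial
  theta series in \<open>r\<close>.\<close>

lemma laurent_coeff_eq_partial_theta:
  assumes "x \<noteq> 0" "norm x < 1"
  shows "laurent_coeff x 1 x (- j) = partial_theta x j / (qpoch_inf x x)\<^sup>2"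
proof -
  obtain M where M: "M > 0" "\<And>n. norm (1 / qpoch x x n) \<le> M"
    by (rule inverse_qpoch_bounded[OF assms(2)]) blast
  \<comment> \<open>\<open>w\<close> extends the reciprocal Pochhammer symbol by 0 to negative
    arguments. This removes the constraint \<open>int a + j \<ge> 0\<close>, and
    \<open>euler_sum_int\<close> then covers every row.\<close>
  define w where "w = (\<lambda>b. if b \<ge> 0 then 1 / qpoch x x (nat b) else 0)"
  define t where "t = (\<lambda>a r. (1 / qpoch x x a * x ^ a) *
                        ((-1) ^ r * x powi (tri (int r) + int r * (int a + j)) / qpoch x x r))"
  have "laurent_coeff x 1 x (- j) = (\<Sum>\<^sub>\<infinity>a\<in>{a. int a + j \<ge> 0}. 1 / qpoch x x a * x ^ a * w (int a + j))"
    unfolding laurent_coeff_def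
    by (rule infsum_reindex_bij_witness[where i = "\<lambda>a. (a, nat (int a + j))" and j = fst])
       (auto simp: w_def nat_eq_iff field_simps)
  also have "\<dots> = (\<Sum>\<^sub>\<infinity>a. 1 / qpoch x x a * x ^ a * w (int a + j))"
    by (rule infsum_cong_neutral) (auto simp: w_def)
  finally have L: "laurent_coeff x 1 x (- j) = (\<Sum>\<^sub>\<infinity>a. 1 / qpoch x x a * x ^ a * w (int a + j))" .
  have row: "(\<Sum>\<^sub>\<infinity>r. t a r) = qpoch_inf x x * (1 / qpoch x x a * x ^ a * w (int a + j))" for a
    unfolding t_def infsum_cmult_right'
    using infsumI[OF euler_sum_int[OF assms, of "int a + j"]] by (simp add: w_def)
  \<comment> \<open>The cross term \<open>r * a\<close> of the exponent joins the powers of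
    \<open>a\<close>, so that each column is Euler's first sum at
    \<open>z = x * x ^ r\<close>.\<close>
  have t_alt: "t a r = ((-1) ^ r * x powi (tri (int r) + int r * j) / qpoch x x r) *
                        (1 / qpoch x x a * (x * x ^ r) ^ a)" for a r
  proof -
    have "x powi (tri (int r) + int r * (int a + j)) = x powi (tri (int r) + int r * j) * x powi (int (r * a))"
      using assms by (subst power_int_add[symmetric]) (auto simp: algebra_simps)
    also have "\<dots> = x powi (tri (int r) + int r * j) * x ^ (r * a)"
      unfolding power_int_of_nat ..
    finally show ?thesis
      by (simp add: t_def power_mult_distrib power_mult[symmetric] mult_ac)
  qed
  \<comment> \<open>The column sum contains
    \<open>1 / qpoch_inf (x * x ^ r) x = qpoch x x r / qpoch_inf x x\<close>, whose numerator
    cancels the \<open>qpoch x x r\<close> in the denominator.\<close>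
  have col: "(\<Sum>\<^sub>\<infinity>a. t a r) = (-1) ^ r * x powi (tri (int r) + int r * j) / qpoch_inf x x" for r
  proof -
    have "norm (x * x ^ r) < 1"
      using power_less_one_iff[of "norm x" "Suc r"] assms by (simp add: norm_mult norm_power)
    then have "(\<Sum>\<^sub>\<infinity>a. 1 / qpoch x x a * (x * x ^ r) ^ a) = 1 / qpoch_inf (x * x ^ r) x"
      by (rule infsumI[OF euler_inverse_sum[OF assms(2)]])
    then show ?thesis
      unfolding t_alt infsum_cmult_right' qpoch_inf_shift[OF assms(2), of x r] by simp
  qed
  have "(\<lambda>(a, r). t a r) summable_on UNIV \<times> UNIV"
  proof (rule summable_on_complex_comparison)
    show "(\<lambda>(a, r). (M * M * norm x ^ a) * norm x powi (tri (int r) + int r * j)) summable_on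
            (UNIV :: nat set) \<times> (UNIV :: nat set)"
      using M assms
      by (intro summable_on_times_nonneg summable_on_cmult_right summable_on_geometric
            summable_on_partial_theta_real) auto
    fix p :: "nat \<times> nat"
    obtain a r where p: "p = (a, r)" by (cases p)
    have "norm (t a r) = norm (1 / qpoch x x a) * norm (1 / qpoch x x r) *
        (norm x ^ a * norm x powi (tri (int r) + int r * j)) * norm (x ^ r) ^ a"
      unfolding t_alt by (simp add: norm_mult norm_divide norm_power norm_power_int power_mult_distrib mult_ac)
    also have "\<dots> \<le> M * M * (norm x ^ a * norm x powi (tri (int r) + int r * j)) * 1"
    proof (intro mult_mono[OF mult_right_mono])
      show "norm (1 / qpoch x x a) * norm (1 / qpoch x x r) \<le> M * M"
        using M(1) by (intro mult_mono M(2)) auto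
      show "norm (x ^ r) ^ a \<le> 1"
        using assms by (simp add: norm_power power_le_one)
    qed (use M(1) in auto)
    finally show "norm (case p of (a, r) \<Rightarrow> t a r) \<le>
        (case p of (a, r) \<Rightarrow> (M * M * norm x ^ a) * norm x powi (tri (int r) + int r * j))"
      by (simp add: p mult_ac)
  qed
  then have "(\<Sum>\<^sub>\<infinity>a. \<Sum>\<^sub>\<infinity>r. t a r) = (\<Sum>\<^sub>\<infinity>r. \<Sum>\<^sub>\<infinity>a. t a r)"
    by (rule infsum_swap_banach)
  then have "qpoch_inf x x * laurent_coeff x 1 x (- j) = partial_theta x j / qpoch_inf x x"
    unfolding row col infsum_cmult_right' L[symmetric] partial_theta_def
    by (simp add: divide_inverse infsum_cmult_left')
  then have "qpoch_inf x x * laurent_coeff x 1 x (- j) / qpoch_inf x x =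
      partial_theta x j / qpoch_inf x x / qpoch_inf x x" by (simp only:)
  then show ?thesis
    using qpoch_inf_nonzero[OF assms(2)] by (simp add: power2_eq_square)
qed

text \<open>Compares the coefficients of \<open>z ^ n\<close> in
  \<open>1/(z;q)_inf = 1/((z;q^2)_inf (qz;q^2)_inf)\<close>. Both sides start at 1 and satisfy
  \<open>d (Suc n) * (1 - q * q ^ n) = d n\<close>.\<close>

lemma inverse_qpoch_square_base:
  assumes "norm q < 1"
  shows "1 / qpoch q q n = (\<Sum>a\<le>n. q ^ (n - a) / (qpoch (q\<^sup>2) (q\<^sup>2) a * qpoch (q\<^sup>2) (q\<^sup>2) (n - a)))"
proof -
  define C where "C = (\<lambda>n. 1 / qpoch (q\<^sup>2) (q\<^sup>2) n)"
  define d where "d = (\<lambda>n. \<Sum>a\<le>n. q ^ (n - a) * C a * C (n - a))"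
  have q2: "norm (q\<^sup>2) < 1" using assms by (simp add: norm_power power_less_one_iff)
  have C: "C (Suc n) * (1 - q ^ (2 * Suc n)) = C n" for n
  proof -
    have "q ^ (2 * Suc n) = q\<^sup>2 * (q\<^sup>2) ^ n" by (simp only: power_mult power_Suc)
    then show ?thesis using inverse_qpoch_Suc[OF q2, of n] by (simp only: C_def)
  qed
  have flip: "d n = (\<Sum>a\<le>n. q ^ a * C a * C (n - a))" for n
    unfolding d_def by (rule sum.reindex_bij_witness[of _ "\<lambda>a. n - a" "\<lambda>a. n - a"]) auto
  have step: "d (Suc n) * (1 - q * q ^ n) = d n" for n
  proof -
    \<comment> \<open>Here \<open>d\<close> is used as defined, whereas the minuend below uses the
      reversed form \<open>flip\<close>. Their difference then carries
      \<open>1 - q ^ (2 * (Suc n - a))\<close>, the factor that lowers the index of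
      \<open>C\<close>.\<close>
    have "d (Suc n) * (q * q ^ n) = (\<Sum>a\<le>Suc n. q ^ a * C a * (q ^ (2 * (Suc n - a)) * C (Suc n - a)))"
      unfolding d_def sum_distrib_right
    proof (rule sum.cong)
      fix a assume "a \<in> {..Suc n}"
      then have "q ^ (Suc n - a) * q ^ Suc n = q ^ a * q ^ (2 * (Suc n - a))"
        unfolding power_add[symmetric] by (intro arg_cong[where f = "\<lambda>k. q ^ k"]) auto
      then show "q ^ (Suc n - a) * C a * C (Suc n - a) * (q * q ^ n) =
         q ^ a * C a * (q ^ (2 * (Suc n - a)) * C (Suc n - a))"
        by (simp add: mult_ac)
    qed simp
    then have "d (Suc n) * (1 - q * q ^ n) = (\<Sum>a\<le>Suc n. q ^ a * C a * C (Suc n - a)) -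
        (\<Sum>a\<le>Suc n. q ^ a * C a * (q ^ (2 * (Suc n - a)) * C (Suc n - a)))"
      unfolding right_diff_distrib mult_1_right using flip[of "Suc n"] by (simp only:)
    also have "\<dots> = (\<Sum>a\<le>Suc n. q ^ a * C a * (C (Suc n - a) * (1 - q ^ (2 * (Suc n - a)))))"
      unfolding sum_subtractf[symmetric] by (intro sum.cong refl) (simp only: right_diff_distrib mult_1_right mult_1_left mult_ac)
    \<comment> \<open>The term \<open>a = Suc n\<close> vanishes, because its last factor is
      \<open>1 - q ^ 0\<close>.\<close>
    also have "\<dots> = (\<Sum>a\<le>n. q ^ a * C a * (C (Suc n - a) * (1 - q ^ (2 * (Suc n - a)))))"
      by simp
    also have "\<dots> = (\<Sum>a\<le>n. q ^ a * C a * C (n - a))"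
    proof (rule sum.cong)
      fix a assume "a \<in> {..n}"
      then show "q ^ a * C a * (C (Suc n - a) * (1 - q ^ (2 * (Suc n - a)))) = q ^ a * C a * C (n - a)"
        using C[of "n - a"] by (simp add: Suc_diff_le)
    qed simp
    finally show ?thesis unfolding flip .
  qed
  have "1 / qpoch q q n = d n"
  proof (induction n)
    case 0
    show ?case by (simp add: d_def C_def)
  next
    case (Suc n)
    have "1 / qpoch q q (Suc n) * (1 - q * q ^ n) = d (Suc n) * (1 - q * q ^ n)"
      unfolding inverse_qpoch_Suc[OF assms] step Suc ..
    then show ?case using one_minus_power_nonzero[OF assms, of n] mult_right_cancel by blast
  qed
  then show ?thesis by (simp add: d_def C_def)
qed

section \<open>Bounds, summability and symmetries of the Laurent coefficients\<close>

lemma summable_on_inj_pullback: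
  fixes g :: "'b \<Rightarrow> real"
  assumes "g summable_on UNIV" "inj_on h A"
  shows "(\<lambda>x. g (h x)) summable_on A"
  using summable_on_reindex[OF assms(2), of g] summable_on_subset_banach[OF assms(1), of "h ` A"]
  by (simp add: o_def)

text \<open>On the diagonal \<open>int m - int n = j\<close> the index \<open>m\<close> determines
  \<open>n\<close>, so the decay in \<open>a\<close> alone suffices and \<open>b = 1\<close> is
  allowed. The geometric series over all \<open>m\<close> bounds every diagonal at once, hence a
  bound independent of \<open>j\<close>.\<close>

lemma
  assumes "norm x < 1" "norm a < 1" "norm b \<le> 1"
  shows summable_on_laurent_coeff:
      "(\<lambda>(m, n). a ^ m * b ^ n / (qpoch x x m * qpoch x x n)) summable_on {(m, n). int m - int n = j}"
        (is "?f summable_on ?S j")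
    and laurent_coeff_bounded: "\<exists>B\<ge>0. \<forall>j. norm (laurent_coeff a b x j) \<le> B"
proof -
  obtain M where M: "M > 0" "\<And>n. norm (1 / qpoch x x n) \<le> M"
    by (rule inverse_qpoch_bounded[OF assms(1)]) blast
  have inj: "inj_on fst (?S j)" for j
    by (auto simp: inj_on_def)
  have geo: "(\<lambda>m. M * M * norm a ^ m) summable_on UNIV"
    using assms by (intro summable_on_cmult_right summable_on_geometric) auto
  have sum: "(\<lambda>p. M * M * norm a ^ fst p) summable_on ?S j" for j
    by (rule summable_on_inj_pullback[OF geo inj])
  have bound: "norm (?f p) \<le> M * M * norm a ^ fst p" for p
  proof -
    obtain m n where p: "p = (m, n)" by (cases p)
    have "norm (?f p) = norm (1 / qpoch x x m) * norm (1 / qpoch x x n) * norm a ^ m * norm b ^ n"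
      by (simp add: p norm_mult norm_divide norm_power)
    also have "\<dots> \<le> M * M * norm a ^ m * 1"
    proof (intro mult_mono[OF mult_right_mono])
      show "norm (1 / qpoch x x m) * norm (1 / qpoch x x n) \<le> M * M"
        using M(1) by (intro mult_mono M(2)) auto
      show "norm b ^ n \<le> 1"
        using assms by (simp add: power_le_one)
    qed (use M(1) in auto)
    finally show ?thesis by (simp add: p)
  qed
  show "?f summable_on ?S j" for j
    by (rule summable_on_complex_comparison[OF sum bound])
  define B where "B = (\<Sum>\<^sub>\<infinity>m. M * M * norm a ^ m)"
  have "norm (laurent_coeff a b x j) \<le> B" for j
  proof -
    have "norm (laurent_coeff a b x j) \<le> (\<Sum>\<^sub>\<infinity>p\<in>?S j. M * M * norm a ^ fst p)"
      unfolding laurent_coeff_def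
      by (rule norm_infsum_le[OF has_sum_infsum has_sum_infsum])
         (use summable_on_complex_comparison[OF sum bound] sum bound in auto)
    also have "\<dots> = (\<Sum>\<^sub>\<infinity>m\<in>fst ` ?S j. M * M * norm a ^ m)"
      by (subst infsum_reindex[OF inj]) (simp add: o_def)
    also have "\<dots> \<le> B"
      unfolding B_def using M(1)
      by (intro infsum_mono_neutral summable_on_subset_banach[OF geo]) (auto intro: geo)
    finally show ?thesis .
  qed
  moreover have "B \<ge> 0"
    unfolding B_def using M(1) by (intro infsum_nonneg) auto
  ultimately show "\<exists>B\<ge>0. \<forall>j. norm (laurent_coeff a b x j) \<le> B" by blast
qed

text \<open>The product of two Euler series is summable over all pairs \<open>(m, n)\<close>;
  sorting the pairs by \<open>int m - int n\<close> gives the coefficients.\<close>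

lemma summable_on_laurent_coeff_int:
  assumes "norm x < 1" "norm a < 1" "norm b < 1"
  shows "laurent_coeff a b x summable_on UNIV"
proof -
  define f where "f = (\<lambda>(m, n). a ^ m * b ^ n / (qpoch x x m * qpoch x x n))"
  have "(\<lambda>m. 1 / qpoch x x m * a ^ m) summable_on UNIV" "(\<lambda>n. 1 / qpoch x x n * b ^ n) summable_on UNIV"
    using euler_inverse_sum[OF assms(1,2)] euler_inverse_sum[OF assms(1,3)] summable_on_def by blast+
  then have "f summable_on UNIV"
    using summable_on_times_complex by (fastforce simp: f_def mult_ac)
  then have "(\<lambda>(j, p). f p) summable_on (SIGMA j:UNIV. {(m, n). int m - int n = j})"
    by (subst summable_on_reindex_bij_witness[where T = UNIV and h = f and j = snd and
          i = "\<lambda>p. (int (fst p) - int (snd p), p)"]) auto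
  then show ?thesis
    unfolding laurent_coeff_def f_def by (rule summable_on_Sigma_banach)
qed

lemma laurent_coeff_commute: "laurent_coeff a b x (- j) = laurent_coeff b a x j"
  unfolding laurent_coeff_def
  by (rule infsum_reindex_bij_witness[where i = "\<lambda>(m, n). (n, m)" and j = "\<lambda>(m, n). (n, m)"])
     (auto simp: mult_ac)

text \<open>Moving the factor \<open>c\<close> from one parameter to the other amounts to replacing
  \<open>w\<close> by \<open>c * w\<close> in the generating function.\<close>

lemma laurent_coeff_balance:
  assumes "c \<noteq> 0"
  shows "laurent_coeff a (b * c) x j = c powi (- j) * laurent_coeff (a * c) b x j"
proof -
  have "c ^ n = c powi (- j) * c ^ m" if "int m - int n = j" for m n
  proof -
    have "int n = - j + int m" using that by simp
    then have "c powi int n = c powi (- j) * c powi int m"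
      by (simp only: power_int_add[OF disjI1[OF assms]])
    then show ?thesis by (simp only: power_int_of_nat)
  qed
  then show ?thesis
    unfolding laurent_coeff_def infsum_cmult_right'[symmetric]
    by (intro infsum_cong) (auto simp: power_mult_distrib)
qed

text \<open>Both sides are Laurent coefficients up to the same constant: exchange the parameters
  \<open>x\<close> and \<open>1\<close>, then move the factor \<open>x\<close> back with
  \<open>laurent_coeff_balance\<close>.\<close>

lemma partial_theta_uminus:
  assumes "x \<noteq> 0" "norm x < 1"
  shows "partial_theta x (- j) = x powi j * partial_theta x j"
proof -
  have "laurent_coeff x 1 x j = laurent_coeff 1 x x (- j)"
    by (simp add: laurent_coeff_commute)
  also have "\<dots> = x powi j * laurent_coeff x 1 x (- j)"
    using laurent_coeff_balance[OF assms(1), of 1 1 x "- j"] by simp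
  finally show ?thesis
    using laurent_coeff_eq_partial_theta[OF assms, of "- j"] laurent_coeff_eq_partial_theta[OF assms, of j]
      qpoch_inf_nonzero[OF assms(2)] by simp
qed

text \<open>Pairs of indices \<open>(r, w)\<close> are grouped by \<open>min r w\<close>: those with \<open>r \<ge> w\<close> give the terms
  \<open>n \<ge> 0\<close>, and those with \<open>r < w\<close> give the terms \<open>n < 0\<close> via \<open>n = - 1 - min r w\<close>.\<close>

lemma partial_theta_mult:
  assumes "x \<noteq> 0" "norm x < 1"
  shows "((\<lambda>n. of_int (sgn_star n) * x powi (2 * tri n) * partial_theta x (n + m)) has_sum
           partial_theta x m * partial_theta x (- m)) UNIV"
proof -
  define u where "u = (\<lambda>j r. (-1) ^ r * x powi (tri (int r) + int r * j))"
  have u: "u j summable_on UNIV" for j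
    unfolding u_def by (rule summable_on_partial_theta[OF assms])
  \<comment> \<open>The second index \<open>k\<close> is \<open>r - w\<close> in the first case and
    \<open>w - r - 1\<close> in the second, so the pairs with \<open>r = w\<close> are counted
    once.\<close>
  define \<beta> where "\<beta> = (\<lambda>(n, k). if n \<ge> 0 then (nat n + k, nat n) else (nat (- 1 - n), nat (- n) + k))"
  have \<beta>: "bij_betw \<beta> (UNIV \<times> UNIV) (UNIV \<times> UNIV)"
    by (rule bij_betwI[where g = "\<lambda>(r, w). if w \<le> r then (int w, r - w) else (- 1 - int r, w - r - 1)"])
       (auto simp: \<beta>_def split: if_splits)
  define V where "V = (\<lambda>(r, w). u m r * u (- m) w)"
  have V: "(V has_sum partial_theta x m * partial_theta x (- m)) (UNIV \<times> UNIV)"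
    using has_sum_infsum[OF summable_on_times_complex[OF u u, of m "- m"]]
      infsum_times_complex[OF u u, of m "- m"]
    by (simp add: V_def partial_theta_def u_def)
  have "((\<lambda>p. V (\<beta> p)) has_sum partial_theta x m * partial_theta x (- m)) (UNIV \<times> UNIV)"
    using V by (subst has_sum_reindex_bij_betw[OF \<beta>])
  moreover have "((\<lambda>k. V (\<beta> (n, k))) has_sum of_int (sgn_star n) * x powi (2 * tri n) * partial_theta x (n + m)) UNIV"
    for n
  proof (cases "n \<ge> 0")
    case True
    have "V (\<beta> (n, k)) = x powi (2 * tri n) * u (n + m) k" for k
    proof -
      have "V (\<beta> (n, k)) = ((-1) ^ (nat n + k) * (-1) ^ nat n) *
          x powi ((tri (n + int k) + (n + int k) * m) + (tri n + n * (- m)))"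
        using True assms by (subst power_int_add) (auto simp: V_def \<beta>_def u_def mult_ac)
      also have "(tri (n + int k) + (n + int k) * m) + (tri n + n * (- m))
           = 2 * tri n + (tri (int k) + int k * (n + m))"
        by (simp add: tri_add algebra_simps)
      also have "((-1) ^ (nat n + k) * (-1) ^ nat n :: complex) = (-1) ^ k"
        by (simp add: power_add flip: power_mult_distrib)
      finally show ?thesis
        using assms by (simp add: u_def power_int_add)
    qed
    then show ?thesis
      using has_sum_cmult_right[OF has_sum_infsum[OF u[of "n + m"]], of "x powi (2 * tri n)"] True
      by (simp add: sgn_star_def partial_theta_def u_def)
  next
    case False
    \<comment> \<open>With this choice \<open>j + 1 = - (n + m)\<close>, and
      \<open>partial_theta_uminus\<close> converts the row sum into a value at
      \<open>n + m\<close>.\<close>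
    define j where "j = - 1 - n - m"
    have "V (\<beta> (n, k)) = - (x powi (2 * tri n) * x powi (j + 1)) * u (j + 1) k" for k
    proof -
      have "V (\<beta> (n, k)) = ((-1) ^ nat (- 1 - n) * (-1) ^ (nat (- n) + k)) *
          x powi ((tri (- 1 - n) + (- 1 - n) * m) + (tri (int k + - n) + (int k + - n) * (- m)))"
        using False assms by (subst power_int_add) (auto simp: V_def \<beta>_def u_def mult_ac add_ac)
      also have "(tri (- 1 - n) + (- 1 - n) * m) + (tri (int k + - n) + (int k + - n) * (- m))
           = 2 * tri n + (j + 1) + (tri (int k) + int k * (j + 1))"
        using two_tri[of n] two_tri[of "- n"] unfolding j_def tri_reflect tri_add
        by (simp add: algebra_simps)
      \<comment> \<open>The two sign exponents differ by \<open>k + 1\<close>; the extra 1 is the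
        minus sign recorded by \<open>sgn_star\<close>.\<close>
      also have "nat (- n) = Suc (nat (- 1 - n))" using False by simp
      also have "((-1) ^ nat (- 1 - n) * (-1) ^ (Suc (nat (- 1 - n)) + k) :: complex) = - ((-1) ^ k)"
        by (simp add: power_add flip: power_mult_distrib)
      finally show ?thesis
        using assms by (simp add: u_def power_int_add)
    qed
    moreover have "partial_theta x (n + m) = x powi (j + 1) * partial_theta x (j + 1)"
      using partial_theta_uminus[OF assms, of "j + 1"] by (simp add: j_def add.commute)
    ultimately show ?thesis
      using has_sum_cmult_right[OF has_sum_infsum[OF u[of "j + 1"]], of "- (x powi (2 * tri n) * x powi (j + 1))"] False
      by (simp add: sgn_star_def partial_theta_def u_def mult.assoc)
  qed
  ultimately show ?thesis
    by (rule has_sum_SigmaD)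
qed

text \<open>This is \<open>(w;q)\<^sub>\<infinity> = (w;q\<^sup>2)\<^sub>\<infinity> (qw;q\<^sup>2)\<^sub>\<infinity>\<close>, applied to \<open>1 / ((qw;q)\<^sub>\<infinity> (1/w;q)\<^sub>\<infinity>)\<close>
  and compared coefficientwise.\<close>

lemma laurent_coeff_convolution:
  assumes "norm q < 1"
  shows "(\<Sum>\<^sub>\<infinity>k. laurent_coeff q q (q\<^sup>2) k * laurent_coeff (q\<^sup>2) 1 (q\<^sup>2) (j - k)) = laurent_coeff q 1 q j"
proof -
  have q2: "norm (q\<^sup>2) < 1" using assms by (simp add: norm_power power_less_one_iff)
  define C where "C = (\<lambda>n. 1 / qpoch (q\<^sup>2) (q\<^sup>2) n)"
  obtain M where M: "M > 0" "\<And>n. norm (C n) \<le> M"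
    unfolding C_def by (rule inverse_qpoch_bounded[OF q2]) blast
  define S where "S = (\<lambda>j. {(m::nat, n::nat). int m - int n = j})"
  define f where "f = (\<lambda>(a, b). q ^ a * q ^ b / (qpoch (q\<^sup>2) (q\<^sup>2) a * qpoch (q\<^sup>2) (q\<^sup>2) b))"
  define g where "g = (\<lambda>(a, b). (q\<^sup>2) ^ a * 1 ^ b / (qpoch (q\<^sup>2) (q\<^sup>2) a * qpoch (q\<^sup>2) (q\<^sup>2) b))"
  define F where "F = (\<lambda>(p, p'). f p * g p')"
  define E where "E = {((a2::nat, b2::nat), (a1::nat, b1::nat)). int a2 - int b2 + int a1 - int b1 = j}"
  have F: "F summable_on E"
  proof (rule summable_on_complex_comparison)
    \<comment> \<open>There is no decay in \<open>b1\<close>, whose parameter is 1. The constraint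
      in \<open>E\<close> determines \<open>b1\<close> from the other three indices, so a majorant
      in those is enough.\<close>
    define h where "h = (\<lambda>((a2::nat, b2::nat), (a1::nat, b1::nat)). (a2, b2, a1))"
    define G where "G = (\<lambda>(a2, b2, a1). M ^ 4 * norm q ^ a2 * (norm q ^ b2 * norm (q\<^sup>2) ^ a1))"
    have "(\<lambda>(b2, a1). norm q ^ b2 * norm (q\<^sup>2) ^ a1) summable_on UNIV \<times> UNIV"
      using assms q2 by (intro summable_on_times_nonneg summable_on_geometric) auto
    then have "(\<lambda>(a2, p). M ^ 4 * norm q ^ a2 * (case p of (b2, a1) \<Rightarrow> norm q ^ b2 * norm (q\<^sup>2) ^ a1))
        summable_on UNIV \<times> (UNIV \<times> UNIV)"
      using assms q2 M(1)
      by (intro summable_on_times_nonneg summable_on_cmult_right summable_on_geometric) auto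
    then have "G summable_on UNIV"
      by (simp add: G_def case_prod_unfold)
    moreover have "inj_on h E"
      by (auto simp: inj_on_def h_def E_def)
    ultimately show "(\<lambda>p. G (h p)) summable_on E"
      by (rule summable_on_inj_pullback)
    fix p :: "(nat \<times> nat) \<times> (nat \<times> nat)"
    obtain a2 b2 a1 b1 where p: "p = ((a2, b2), (a1, b1))" by (metis surj_pair)
    have "norm (F p) = (norm (C a2) * norm (C b2) * (norm (C a1) * norm (C b1))) *
            (norm q ^ a2 * (norm q ^ b2 * norm (q\<^sup>2) ^ a1))"
      by (simp add: p F_def f_def g_def C_def norm_mult norm_divide norm_power mult_ac)
    also have "\<dots> \<le> (M * M * (M * M)) * (norm q ^ a2 * (norm q ^ b2 * norm (q\<^sup>2) ^ a1))"
      using M(1) by (intro mult_right_mono mult_mono M(2)) auto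
    finally show "norm (F p) \<le> G (h p)"
      by (simp add: p G_def h_def power4_eq_xxxx mult_ac)
  qed
  have f: "f summable_on S k" for k
    unfolding f_def S_def using assms q2 by (intro summable_on_laurent_coeff) auto
  have g: "g summable_on S k" for k
    unfolding g_def S_def using assms q2 by (intro summable_on_laurent_coeff) auto
  have "(\<Sum>\<^sub>\<infinity>k. laurent_coeff q q (q\<^sup>2) k * laurent_coeff (q\<^sup>2) 1 (q\<^sup>2) (j - k))
      = (\<Sum>\<^sub>\<infinity>k. infsum F (S k \<times> S (j - k)))"
    unfolding F_def infsum_times_complex[OF f g, symmetric]
    by (simp add: laurent_coeff_def f_def g_def S_def)
  also have "\<dots> = (\<Sum>\<^sub>\<infinity>(k, p)\<in>(SIGMA k:UNIV. S k \<times> S (j - k)). F p)"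
  proof (rule infsum_Sigma'_banach)
    show "(\<lambda>(k, p). F p) summable_on (SIGMA k:UNIV. S k \<times> S (j - k))"
      using F
      by (subst summable_on_reindex_bij_witness[where T = E and h = F and j = snd and
            i = "\<lambda>p. (int (fst (fst p)) - int (snd (fst p)), p)"]) (auto simp: E_def S_def)
  qed
  also have "\<dots> = infsum F E"
    by (rule infsum_reindex_bij_witness[where j = snd and
            i = "\<lambda>p. (int (fst (fst p)) - int (snd (fst p)), p)"]) (auto simp: E_def S_def)
  finally have lhs: "(\<Sum>\<^sub>\<infinity>k. laurent_coeff q q (q\<^sup>2) k * laurent_coeff (q\<^sup>2) 1 (q\<^sup>2) (j - k)) = infsum F E" .

  \<comment> \<open>Regroups the quadruples by the totals \<open>a = a1 + a2\<close> and
    \<open>b = b1 + b2\<close>, which satisfy \<open>int a - int b = j\<close>. Over each pair of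
    totals lies a finite rectangle, parametrized by \<open>(a2, b1)\<close>.\<close>
  define T where "T = (SIGMA p:S j. {..fst p} \<times> {..snd p})"
  define i where "i = (\<lambda>((a2::nat, b2::nat), (a1::nat, b1::nat)). ((a1 + a2, b1 + b2), (a2, b1)))"
  define i' where "i' = (\<lambda>((a::nat, b::nat), (a2::nat, b1::nat)). ((a2, b - b1), (a - a2, b1)))"
  have ii': "i p \<in> T" if "p \<in> E" for p
    using that by (auto simp: i_def T_def E_def S_def)
  have i'i: "i' p \<in> E" if "p \<in> T" for p
    using that by (auto simp: i'_def T_def E_def S_def)
  have i'_i: "i' (i p) = p" for p
    by (auto simp: i_def i'_def split: prod.splits)
  have i_i': "i (i' p) = p" if "p \<in> T" for p
    using that by (auto simp: i_def i'_def T_def)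
  have FT: "(\<lambda>p. F (i' p)) summable_on T"
    using F by (subst summable_on_reindex_bij_witness[where T = E and h = F and j = i' and i = i])
      (auto intro: ii' i'i i'_i i_i')
  have "infsum F E = (\<Sum>\<^sub>\<infinity>p\<in>T. F (i' p))"
    by (rule infsum_reindex_bij_witness[where i = i' and j = i]) (auto simp: ii' i'i i'_i i_i')
  also have "\<dots> = (\<Sum>\<^sub>\<infinity>p\<in>S j. \<Sum>\<^sub>\<infinity>p'\<in>{..fst p} \<times> {..snd p}. F (i' (p, p')))"
    unfolding T_def using FT[unfolded T_def] by (rule infsum_Sigma_banach[symmetric])
  also have "\<dots> = (\<Sum>\<^sub>\<infinity>(a, b)\<in>S j. q ^ a * 1 ^ b / (qpoch q q a * qpoch q q b))"
  proof (rule infsum_cong)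
    fix p assume "p \<in> S j"
    obtain a b where p: "p = (a, b)" by (cases p)
    have "(\<Sum>\<^sub>\<infinity>p'\<in>{..a} \<times> {..b}. F (i' (p, p'))) = (\<Sum>(a2, b1)\<in>{..a} \<times> {..b}. F (i' (p, (a2, b1))))"
      by (simp add: case_prod_unfold)
    also have "\<dots> = (\<Sum>(a2, b1)\<in>{..a} \<times> {..b}. (q ^ a * (q ^ (a - a2) * C a2 * C (a - a2))) *
                        (q ^ (b - b1) * C b1 * C (b - b1)))"
    proof (rule sum.cong; clarsimp)
      fix a2 b1 assume "a2 \<le> a" "b1 \<le> b"
      then have "q ^ a2 * (q\<^sup>2) ^ (a - a2) = q ^ a * q ^ (a - a2)"
        unfolding power_mult[symmetric] power_add[symmetric] by (intro arg_cong[where f = "\<lambda>k. q ^ k"]) auto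
      then have "(q ^ a2 * (q\<^sup>2) ^ (a - a2)) * (q ^ (b - b1) * (C a2 * C (b - b1) * (C (a - a2) * C b1)))
         = (q ^ a * q ^ (a - a2)) * (q ^ (b - b1) * (C a2 * C (b - b1) * (C (a - a2) * C b1)))"
        by (simp only:)
      moreover have "F (i' (p, a2, b1)) =
          (q ^ a2 * (q\<^sup>2) ^ (a - a2)) * (q ^ (b - b1) * (C a2 * C (b - b1) * (C (a - a2) * C b1)))"
        by (simp add: F_def i'_def f_def g_def C_def p mult_ac)
      ultimately show "F (i' (p, a2, b1)) = q ^ a * (q ^ (a - a2) * C a2 * C (a - a2)) * (q ^ (b - b1) * C b1 * C (b - b1))"
        by (simp only: mult_ac)
    qed
    \<comment> \<open>The sum over the rectangle factors, and each factor is an instance of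
      \<open>inverse_qpoch_square_base\<close>.\<close>
    also have "\<dots> = q ^ a * (\<Sum>a2\<le>a. q ^ (a - a2) * C a2 * C (a - a2)) * (\<Sum>b1\<le>b. q ^ (b - b1) * C b1 * C (b - b1))"
      unfolding sum_distrib_left[of "q ^ a"] sum_product sum.cartesian_product ..
    also have "\<dots> = q ^ a * (1 / qpoch q q a) * (1 / qpoch q q b)"
      unfolding inverse_qpoch_square_base[OF assms] by (simp add: C_def)
    finally show "(\<Sum>\<^sub>\<infinity>p'\<in>{..fst p} \<times> {..snd p}. F (i' (p, p'))) =
        (case p of (a, b) \<Rightarrow> q ^ a * 1 ^ b / (qpoch q q a * qpoch q q b))"
      by (simp add: p)
  qed
  finally show ?thesis
    unfolding lhs by (simp add: laurent_coeff_def S_def)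
qed

section \<open>The cubic sum\<close>

text \<open>For fixed \<open>n4 = k\<close> the exponent \<open>3 * nat \<bar>k\<bar>\<close> is
  shared equally, and the summand splits into three copies of \<open>g k\<close>. Each copy sums to
  a Laurent coefficient, since \<open>q ^ (2 * n + nat \<bar>k\<bar>)\<close> is the weight of the
  pair \<open>(n + nat \<bar>k\<bar>, n)\<close>.\<close>

lemma infsum_laurent_cube:
  assumes "norm q < 1"
  shows "(\<Sum>\<^sub>\<infinity>(n1, n2, n3, n4) \<in> (UNIV :: (nat \<times> nat \<times> nat \<times> int) set).
          q ^ (2 * n1 + 2 * n2 + 2 * n3 + 3 * nat \<bar>n4\<bar>) /
          (qpoch (q\<^sup>2) (q\<^sup>2) n1 * qpoch (q\<^sup>2) (q\<^sup>2) (n1 + nat \<bar>n4\<bar>) *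
           qpoch (q\<^sup>2) (q\<^sup>2) n2 * qpoch (q\<^sup>2) (q\<^sup>2) (n2 + nat \<bar>n4\<bar>) *
           qpoch (q\<^sup>2) (q\<^sup>2) n3 * qpoch (q\<^sup>2) (q\<^sup>2) (n3 + nat \<bar>n4\<bar>)))
    = (\<Sum>\<^sub>\<infinity>k. laurent_coeff q q (q\<^sup>2) k ^ 3)" (is "infsum ?t UNIV = _")
proof -
  have q2: "norm (q\<^sup>2) < 1" using assms by (simp add: norm_power power_less_one_iff)
  define C where "C = (\<lambda>n. 1 / qpoch (q\<^sup>2) (q\<^sup>2) n)"
  obtain M where M: "M > 0" "\<And>n. norm (C n) \<le> M"
    unfolding C_def by (rule inverse_qpoch_bounded[OF q2]) blast
  define g where "g = (\<lambda>k n. q ^ (2 * n + nat \<bar>k\<bar>) * C n * C (n + nat \<bar>k\<bar>))"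
  have g_bound: "norm (g k n) \<le> (M * M * norm q ^ nat \<bar>k\<bar>) * norm (q\<^sup>2) ^ n" for k n
  proof -
    have "norm (g k n) = (norm (C n) * norm (C (n + nat \<bar>k\<bar>))) * (norm q ^ nat \<bar>k\<bar> * norm (q\<^sup>2) ^ n)"
      by (simp add: g_def norm_mult norm_power power_add power_mult)
    also have "\<dots> \<le> (M * M) * (norm q ^ nat \<bar>k\<bar> * norm (q\<^sup>2) ^ n)"
      using M(1) by (intro mult_right_mono mult_mono M(2)) auto
    finally show ?thesis by (simp add: mult_ac)
  qed
  have g_sum: "g k summable_on UNIV" for k
    using q2 by (intro summable_on_complex_comparison[OF _ g_bound] summable_on_cmult_right summable_on_geometric) auto
  have g_infsum: "(\<Sum>\<^sub>\<infinity>n. g k n) = laurent_coeff q q (q\<^sup>2) k" for k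
  proof -
    have "g k n = q ^ (n + nat \<bar>k\<bar>) * q ^ n / (qpoch (q\<^sup>2) (q\<^sup>2) (n + nat \<bar>k\<bar>) * qpoch (q\<^sup>2) (q\<^sup>2) n)" for n
    proof -
      have "q ^ (2 * n + nat \<bar>k\<bar>) = q ^ (n + nat \<bar>k\<bar>) * q ^ n"
        unfolding power_add[symmetric] by (intro arg_cong[where f = "\<lambda>k. q ^ k"]) simp
      then show ?thesis by (simp add: g_def C_def)
    qed
    then have "(\<Sum>\<^sub>\<infinity>n. g k n) = laurent_coeff q q (q\<^sup>2) \<bar>k\<bar>"
      unfolding laurent_coeff_def
      by (intro infsum_reindex_bij_witness[where i = snd and j = "\<lambda>n. (n + nat \<bar>k\<bar>, n)"])
         auto
    \<comment> \<open>Both parameters equal \<open>q\<close>, so the coefficient is even in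
      \<open>k\<close>.\<close>
    then show ?thesis
      by (cases "k \<ge> 0") (auto simp: laurent_coeff_commute)
  qed
  define F where "F = (\<lambda>k (n1, n2, n3). g k n1 * (g k n2 * g k n3))"
  have inner: "infsum (F k) UNIV = laurent_coeff q q (q\<^sup>2) k ^ 3" for k
  proof -
    have s2: "(\<lambda>(n2, n3). g k n2 * g k n3) summable_on UNIV \<times> UNIV"
      by (rule summable_on_times_complex[OF g_sum g_sum])
    have "infsum (F k) UNIV = (\<Sum>\<^sub>\<infinity>(n1, p)\<in>UNIV \<times> (UNIV \<times> UNIV). g k n1 * (case p of (n2, n3) \<Rightarrow> g k n2 * g k n3))"
      by (simp add: F_def case_prod_unfold)
    also have "\<dots> = infsum (g k) UNIV * (infsum (g k) UNIV * infsum (g k) UNIV)"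
      by (simp only: infsum_times_complex[OF g_sum s2, symmetric] infsum_times_complex[OF g_sum g_sum, symmetric])
    finally show ?thesis by (simp add: g_infsum power3_eq_cube)
  qed
  have "(\<lambda>(k, p). F k p) summable_on UNIV \<times> UNIV"
  proof (rule summable_on_complex_comparison)
    define \<gamma> where "\<gamma> = (\<lambda>n::nat. norm (q\<^sup>2) ^ n)"
    have \<gamma>: "\<gamma> summable_on UNIV" unfolding \<gamma>_def using q2 by (intro summable_on_geometric) auto
    have \<gamma>_nonneg: "\<gamma> n \<ge> 0" for n by (simp add: \<gamma>_def)
    have s2: "(\<lambda>(n2, n3). \<gamma> n2 * \<gamma> n3) summable_on UNIV \<times> UNIV"
      by (rule summable_on_times_nonneg[OF \<gamma> \<gamma> \<gamma>_nonneg \<gamma>_nonneg])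
    have s3: "(\<lambda>(n1, p). \<gamma> n1 * (case p of (n2, n3) \<Rightarrow> \<gamma> n2 * \<gamma> n3)) summable_on UNIV \<times> (UNIV \<times> UNIV)"
      by (rule summable_on_times_nonneg[OF \<gamma> s2]) (auto simp: \<gamma>_nonneg)
    have sk: "(\<lambda>k::int. M ^ 6 * norm q ^ nat \<bar>k\<bar>) summable_on UNIV"
      using assms by (intro summable_on_cmult_right summable_on_geometric_int) auto
    show "(\<lambda>(k::int, p'). (M ^ 6 * norm q ^ nat \<bar>k\<bar>) *
        (case p' of (n1, p) \<Rightarrow> \<gamma> n1 * (case p of (n2, n3) \<Rightarrow> \<gamma> n2 * \<gamma> n3))) summable_on UNIV \<times> UNIV"
      using summable_on_times_nonneg[OF sk s3] M(1) by (simp add: \<gamma>_nonneg case_prod_unfold)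
    fix z :: "int \<times> nat \<times> nat \<times> nat"
    obtain k n1 n2 n3 where z: "z = (k, n1, n2, n3)" by (metis surj_pair)
    have "norm (F k (n1, n2, n3)) \<le> ((M * M * norm q ^ nat \<bar>k\<bar>) * \<gamma> n1) *
       (((M * M * norm q ^ nat \<bar>k\<bar>) * \<gamma> n2) * ((M * M * norm q ^ nat \<bar>k\<bar>) * \<gamma> n3))"
      unfolding F_def \<gamma>_def using M(1)
      by (simp only: norm_mult prod.case) (intro mult_mono g_bound mult_nonneg_nonneg; simp)
    also have "\<dots> = norm q ^ nat \<bar>k\<bar> * norm q ^ nat \<bar>k\<bar> * ((M ^ 6 * norm q ^ nat \<bar>k\<bar>) * (\<gamma> n1 * (\<gamma> n2 * \<gamma> n3)))"
      by (simp add: eval_nat_numeral mult_ac)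
    \<comment> \<open>One power of \<open>norm q ^ nat \<bar>k\<bar>\<close> is enough for
      summability over \<open>k\<close>; the other two are bounded by 1.\<close>
    also have "\<dots> \<le> 1 * 1 * ((M ^ 6 * norm q ^ nat \<bar>k\<bar>) * (\<gamma> n1 * (\<gamma> n2 * \<gamma> n3)))"
      using M(1) assms
      by (intro mult_right_mono mult_mono power_le_one mult_nonneg_nonneg \<gamma>_nonneg; simp)
    finally show "norm (case z of (k, p) \<Rightarrow> F k p) \<le> (case z of (k, p') \<Rightarrow> (M ^ 6 * norm q ^ nat \<bar>k\<bar>) *
        (case p' of (n1, p) \<Rightarrow> \<gamma> n1 * (case p of (n2, n3) \<Rightarrow> \<gamma> n2 * \<gamma> n3)))"
      by (simp add: z)
  qed
  then have "(\<Sum>\<^sub>\<infinity>k. infsum (F k) UNIV) = (\<Sum>\<^sub>\<infinity>(k, p)\<in>UNIV \<times> UNIV. F k p)"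
    by (rule infsum_Sigma'_banach)
  also have "\<dots> = infsum ?t UNIV"
    by (rule infsum_reindex_bij_witness[where i = "\<lambda>(n1, n2, n3, k). (k, n1, n2, n3)"
          and j = "\<lambda>(k, n1, n2, n3). (n1, n2, n3, k)"])
       (auto simp: F_def g_def C_def power_add[symmetric] algebra_simps)
  finally show ?thesis by (simp add: inner)
qed

text \<open>The exponent equals \<open>tri (int r + n) + 3 * tri n\<close>, so the injective shift
  \<open>(r, n)\<close> to \<open>(int r + n, n)\<close> yields a product of two summable families
  as majorant.\<close>

lemma summable_on_theta_double:
  fixes q :: complex
  assumes "q \<noteq> 0" "norm q < 1"
  shows "(\<lambda>(r, n). of_int (sgn_star n) * (-1) ^ r * q powi (tri (int r) + int r * n + 4 * tri n))
           summable_on UNIV \<times> UNIV"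
proof (rule summable_on_complex_comparison)
  define h where "h = (\<lambda>(r::nat, n::int). (int r + n, n))"
  define G where "G = (\<lambda>(a, b). norm q powi tri a * (norm q ^ 3) powi tri b)"
  have "(\<lambda>(a, b). norm q powi tri a * (norm q ^ 3) powi tri b) summable_on UNIV \<times> UNIV"
    using assms by (intro summable_on_times_nonneg summable_on_tri) (auto simp: power_less_one_iff)
  then have "G summable_on UNIV" by (simp add: G_def)
  moreover have "inj_on h (UNIV \<times> UNIV)" by (auto simp: inj_on_def h_def)
  ultimately show "(\<lambda>p. G (h p)) summable_on UNIV \<times> UNIV"
    by (rule summable_on_inj_pullback)
  fix p :: "nat \<times> int"
  obtain r n where p: "p = (r, n)" by (cases p)
  have "norm (of_int (sgn_star n) * (-1) ^ r * q powi (tri (int r) + int r * n + 4 * tri n)) =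
      norm q powi (tri (int r + n) + 3 * tri n)"
    by (simp add: sgn_star_def norm_mult norm_power norm_power_int tri_add algebra_simps)
  also have "\<dots> = norm q powi tri (int r + n) * norm q powi (int 3 * tri n)"
    using assms by (subst power_int_add) auto
  also have "\<dots> = norm q powi tri (int r + n) * (norm q ^ 3) powi tri n"
    unfolding power_int_mult power_int_of_nat ..
  finally show "norm (case p of (r, n) \<Rightarrow> of_int (sgn_star n) * (-1) ^ r *
      q powi (tri (int r) + int r * n + 4 * tri n)) \<le> G (h p)"
    by (simp add: p G_def h_def)
qed

lemma theta_double_sum_eq_laurent_cubes:
  fixes q :: complex
  assumes "q \<noteq> 0" "norm q < 1"
  shows "inverse ((qpoch_inf q q)\<^sup>2 * (qpoch_inf (q\<^sup>2) (q\<^sup>2))\<^sup>2) *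
      (\<Sum>\<^sub>\<infinity>(r, n). of_int (sgn_star n) * (-1) ^ r * q powi (tri (int r) + int r * n + 4 * tri n))
    = (\<Sum>\<^sub>\<infinity>k. laurent_coeff q q (q\<^sup>2) k ^ 3)"
proof -
  define Q where "Q = q\<^sup>2"
  have Q: "Q \<noteq> 0" "norm Q < 1"
    using assms by (auto simp: Q_def norm_power power_less_one_iff)
  define G where "G = laurent_coeff q q Q"
  define H where "H = laurent_coeff Q 1 Q"
  define K where "K = laurent_coeff q 1 q"
  define s where "s = (\<lambda>n. of_int (sgn_star n) * q powi (4 * tri n))"
  have s_alt: "s n = of_int (sgn_star n) * Q powi (2 * tri n)" for n
  proof -
    have "Q powi (2 * tri n) = (q powi 2) powi (2 * tri n)" by (simp add: Q_def)
    also have "\<dots> = q powi (2 * (2 * tri n))" by (simp only: power_int_mult)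
    finally show ?thesis by (simp add: s_def)
  qed
  \<comment> \<open>\<open>G\<close> has parameters \<open>q\<close> and \<open>q\<close>,
    \<open>H\<close> has \<open>q * q\<close> and 1: one factor \<open>q\<close> changes
    sides.\<close>
  have G_H: "G k = q powi (- k) * H k" for k
    using laurent_coeff_balance[OF assms(1), of q 1 Q k] by (simp add: G_def H_def Q_def power2_eq_square)
  have G_minus: "G (- k) = G k" for k
    unfolding G_def by (rule laurent_coeff_commute)
  have H_P: "H (- j) = partial_theta Q j / (qpoch_inf Q Q)\<^sup>2" for j
    unfolding H_def by (rule laurent_coeff_eq_partial_theta[OF Q])
  have K_P: "K (- j) = partial_theta q j / (qpoch_inf q q)\<^sup>2" for j
    unfolding K_def by (rule laurent_coeff_eq_partial_theta[OF assms])
  have G_square: "(G k)\<^sup>2 * (qpoch_inf Q Q)\<^sup>2 = (\<Sum>\<^sub>\<infinity>n. s n * H (- n - k))" for k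
  proof -
    \<comment> \<open>Replacing one factor by \<open>G (- k)\<close> makes the powers of
      \<open>q\<close> from \<open>G_H\<close> cancel and leaves the product of theta values at
      \<open>k\<close> and \<open>- k\<close> that \<open>partial_theta_mult\<close>
      expands.\<close>
    have "(G k)\<^sup>2 = G k * G (- k)" by (simp add: G_minus power2_eq_square)
    also have "\<dots> = (q powi (- k) * q powi k) * (H (- k) * H (- (- k)))"
      by (simp add: G_H)
    also have "q powi (- k) * q powi k = 1"
      using assms by (simp add: power_int_minus)
    finally have "(G k)\<^sup>2 * (qpoch_inf Q Q)\<^sup>2 = partial_theta Q k * partial_theta Q (- k) / (qpoch_inf Q Q)\<^sup>2"
      unfolding H_P using qpoch_inf_nonzero[OF Q(2)] by (simp add: power4_eq_xxxx power2_eq_square)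
    also have "\<dots> = (\<Sum>\<^sub>\<infinity>n. s n * partial_theta Q (n + k)) / (qpoch_inf Q Q)\<^sup>2"
      using infsumI[OF partial_theta_mult[OF Q, of k]] by (simp add: s_alt)
    also have "\<dots> = (\<Sum>\<^sub>\<infinity>n. s n * H (- (n + k)))"
      unfolding H_P by (simp add: divide_inverse infsum_cmult_left' mult.assoc[symmetric])
    finally show ?thesis by simp
  qed
  \<comment> \<open>A uniform bound on \<open>H\<close> suffices for the exchange of sums, as
    \<open>G\<close> and \<open>s\<close> are both summable.\<close>
  obtain B where B: "B \<ge> 0" "\<And>j. norm (H j) \<le> B"
    unfolding H_def using laurent_coeff_bounded[of Q Q 1] Q by auto
  have s_sum: "s summable_on UNIV"
  proof (rule summable_on_complex_comparison)
    show "(\<lambda>n. (norm q ^ 4) powi tri n) summable_on UNIV"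
      using assms by (intro summable_on_tri) (auto simp: power_less_one_iff)
    have "norm (s n) = (norm q powi int 4) powi tri n" for n
      unfolding power_int_mult[symmetric] by (simp add: s_def sgn_star_def norm_mult norm_power_int)
    then show "norm (s n) \<le> (norm q ^ 4) powi tri n" for n
      unfolding power_int_of_nat by simp
  qed
  have G_sum: "G summable_on UNIV"
    unfolding G_def using assms Q by (intro summable_on_laurent_coeff_int) auto
  have "(\<lambda>(k, n). G k * (s n * H (- n - k))) summable_on UNIV \<times> UNIV"
  proof (rule summable_on_complex_comparison)
    have "(\<lambda>(k, n). norm (G k) * norm (s n)) summable_on UNIV \<times> UNIV"
      using G_sum s_sum by (intro summable_on_times_nonneg) (auto simp flip: summable_on_iff_abs_summable_on_complex)
    then show "(\<lambda>p. B * (case p of (k, n) \<Rightarrow> norm (G k) * norm (s n))) summable_on UNIV \<times> UNIV"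
      by (rule summable_on_cmult_right)
    show "norm (case p of (k, n) \<Rightarrow> G k * (s n * H (- n - k))) \<le> B * (case p of (k, n) \<Rightarrow> norm (G k) * norm (s n))" for p
      using mult_left_mono[OF B(2)[of "- snd p - fst p"], of "norm (G (fst p)) * norm (s (snd p))"]
      by (simp add: case_prod_unfold norm_mult mult_ac)
  qed
  then have swap: "(\<Sum>\<^sub>\<infinity>k. \<Sum>\<^sub>\<infinity>n. G k * (s n * H (- n - k))) = (\<Sum>\<^sub>\<infinity>n. \<Sum>\<^sub>\<infinity>k. G k * (s n * H (- n - k)))"
    by (rule infsum_swap_banach)
  have "G k * ((G k)\<^sup>2 * (qpoch_inf Q Q)\<^sup>2) = G k ^ 3 * (qpoch_inf Q Q)\<^sup>2" for k
    by (simp add: power3_eq_cube power2_eq_square)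
  then have "(\<Sum>\<^sub>\<infinity>k. G k ^ 3) * (qpoch_inf Q Q)\<^sup>2 = (\<Sum>\<^sub>\<infinity>k. G k * ((G k)\<^sup>2 * (qpoch_inf Q Q)\<^sup>2))"
    by (simp only: infsum_cmult_left')
  also have "\<dots> = (\<Sum>\<^sub>\<infinity>n. s n * (\<Sum>\<^sub>\<infinity>k. G k * H (- n - k)))"
    unfolding G_square infsum_cmult_right'[symmetric] swap by (simp only: mult_ac)
  \<comment> \<open>The indices \<open>k\<close> and \<open>- n - k\<close> add up to
    \<open>- n\<close>, so the inner sum is a convolution and gives the coefficient
    \<open>K (- n)\<close> in base \<open>q\<close>.\<close>
  also have "\<dots> = (\<Sum>\<^sub>\<infinity>n. s n * K (- n))"
    unfolding G_def H_def K_def Q_def laurent_coeff_convolution[OF assms(2)] ..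
  also have "\<dots> = (\<Sum>\<^sub>\<infinity>n. s n * partial_theta q n) / (qpoch_inf q q)\<^sup>2"
    unfolding K_P by (simp add: divide_inverse infsum_cmult_left' mult.assoc[symmetric])
  also have "(\<Sum>\<^sub>\<infinity>n. s n * partial_theta q n) =
      (\<Sum>\<^sub>\<infinity>n. \<Sum>\<^sub>\<infinity>r. of_int (sgn_star n) * (-1) ^ r * q powi (tri (int r) + int r * n + 4 * tri n))"
    unfolding partial_theta_def infsum_cmult_right'[symmetric] s_def using assms
    by (simp add: power_int_add mult_ac)
  also have "\<dots> = (\<Sum>\<^sub>\<infinity>r. \<Sum>\<^sub>\<infinity>n. of_int (sgn_star n) * (-1) ^ r * q powi (tri (int r) + int r * n + 4 * tri n))"
    by (rule infsum_swap_banach[OF summable_on_theta_double[OF assms], symmetric])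
  also have "\<dots> = (\<Sum>\<^sub>\<infinity>(r, n). of_int (sgn_star n) * (-1) ^ r * q powi (tri (int r) + int r * n + 4 * tri n))"
    using infsum_Sigma'_banach[OF summable_on_theta_double[OF assms]] by simp
  finally have *: "(\<Sum>\<^sub>\<infinity>k. G k ^ 3) * (qpoch_inf Q Q)\<^sup>2 =
      (\<Sum>\<^sub>\<infinity>(r, n). of_int (sgn_star n) * (-1) ^ r * q powi (tri (int r) + int r * n + 4 * tri n)) /
        (qpoch_inf q q)\<^sup>2" .
  have "inverse (d * c) * S = A" if "A * c = S / d" "c \<noteq> 0" "d \<noteq> 0" for A S c d :: complex
    using that by (simp add: field_simps)
  from this[OF *] show ?thesis
    using qpoch_inf_nonzero[OF assms(2)] qpoch_inf_nonzero[OF Q(2)]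
    unfolding Q_def G_def by (simp only: power_eq_0_iff simp_thms)
qed

theorem theorem1p2:
  fixes q :: complex
  assumes "norm q < 1"
  shows "inverse ((qpoch_inf q q)\<^sup>2 * (qpoch_inf (q\<^sup>2) (q\<^sup>2))\<^sup>2) *
      (\<Sum>\<^sub>\<infinity>(n1, n2) \<in> (UNIV :: (nat \<times> int) set).
          of_int (sgn_star n2) * (-1) ^ n1 *
          q powi (int n1 * (int n1 + 1) div 2 + int n1 * n2 + 2 * n2\<^sup>2 + 2 * n2))
    = (\<Sum>\<^sub>\<infinity>(n1, n2, n3, n4) \<in> (UNIV :: (nat \<times> nat \<times> nat \<times> int) set).
          q ^ (2 * n1 + 2 * n2 + 2 * n3 + 3 * nat \<bar>n4\<bar>) /
          (qpoch (q\<^sup>2) (q\<^sup>2) n1 * qpoch (q\<^sup>2) (q\<^sup>2) (n1 + nat \<bar>n4\<bar>) *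
           qpoch (q\<^sup>2) (q\<^sup>2) n2 * qpoch (q\<^sup>2) (q\<^sup>2) (n2 + nat \<bar>n4\<bar>) *
           qpoch (q\<^sup>2) (q\<^sup>2) n3 * qpoch (q\<^sup>2) (q\<^sup>2) (n3 + nat \<bar>n4\<bar>)))"
proof -
  have e: "int r * (int r + 1) div 2 + int r * n + 2 * n\<^sup>2 + 2 * n = tri (int r) + int r * n + 4 * tri n" for r n
    using two_tri[of n] by (simp add: tri_def[of "int r"] power2_eq_square algebra_simps)
  show ?thesis
  \<comment> \<open>The general argument involves negative powers of \<open>q\<close>, so
    \<open>q = 0\<close> is evaluated directly.\<close>
  proof (cases "q = 0")
    case False
    show ?thesis
      using theta_double_sum_eq_laurent_cubes[OF False assms] unfolding e infsum_laurent_cube[OF assms] .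
  next
    case True
    \<comment> \<open>The exponent is a sum of nonnegative terms, so \<open>int r + n\<close> and
      \<open>n\<close> must both lie in \<open>{0, - 1}\<close>; the combination
      \<open>r = - 1\<close>, \<open>n = 0\<close> is excluded.\<close>
    have zero: "tri (int r) + int r * n + 4 * tri n = 0 \<longleftrightarrow> (r, n) \<in> {(0, 0), (0, - 1), (1, - 1)}" for r n
    proof -
      have eq: "tri (int r) + int r * n + 4 * tri n = tri (int r + n) + 3 * tri n"
        by (simp add: tri_add)
      have tri_0: "tri t = 0 \<longleftrightarrow> t = 0 \<or> t = - 1" for t
        using two_tri[of t] by auto
      show ?thesis
        unfolding eq using tri_nonneg[of "int r + n"] tri_nonneg[of n] tri_0[of "int r + n"] tri_0[of n]
        by auto
    qed
    define t where "t = (\<lambda>(r, n). of_int (sgn_star n) * (-1) ^ r *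
       (0 :: complex) powi (tri (int r) + int r * n + 4 * tri n))"
    have "t p = 0" if "p \<notin> {(0, 0), (0, - 1), (1, - 1)}" for p
      using that zero[of "fst p" "snd p"] by (simp add: t_def case_prod_unfold power_int_0_left_if)
    then have "infsum t UNIV = infsum t {(0, 0), (0, - 1), (1, - 1)}"
      by (intro infsum_cong_neutral) auto
    \<comment> \<open>As \<open>0 powi 0 = 1\<close>, the three terms contribute \<open>1\<close>,
      \<open>- 1\<close> and \<open>1\<close>.\<close>
    also have "\<dots> = 1"
      by (simp add: t_def sgn_star_def tri_def)
    finally have lhs: "infsum t UNIV = 1" .
    have rhs: "(\<Sum>\<^sub>\<infinity>(n1, n2, n3, n4) \<in> (UNIV :: (nat \<times> nat \<times> nat \<times> int) set).
          (0::complex) ^ (2 * n1 + 2 * n2 + 2 * n3 + 3 * nat \<bar>n4\<bar>) /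
          (qpoch 0 0 n1 * qpoch 0 0 (n1 + nat \<bar>n4\<bar>) *
           qpoch 0 0 n2 * qpoch 0 0 (n2 + nat \<bar>n4\<bar>) *
           qpoch 0 0 n3 * qpoch 0 0 (n3 + nat \<bar>n4\<bar>))) = (\<Sum>\<^sub>\<infinity>_\<in>{(0::nat, 0::nat, 0::nat, 0::int)}. 1)"
      by (rule infsum_cong_neutral) (auto simp: qpoch_def power_0_left split: if_splits)
    have "qpoch_inf 0 0 = 1"
      by (simp add: qpoch_inf_def)
    then show ?thesis
      unfolding e True using lhs rhs by (simp add: t_def)
  qed
qed

end
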